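(* For every integer $n\geq 1$, the sum of all $2^{n-1}$ elements of the $n$th generation of the Calkin--Wilf tree equals $$\Sigma(n)=\sum_{j=1}^{2^{n-1}}x_j^{(n)}=3\cdot 2^{n-2}-\frac12 .$$
   Context: The Calkin--Wilf tree is the infinite rooted binary tree whose vertices are labelled by positive rationals, generated from the root $\frac11$ by giving each vertex labelled $\frac ab$ (reduced fraction) a left child $\frac{a}{a+b}$ and a right child $\frac{a+b}{b}$. The $n$th generation is the set of $2^{n-1}$ vertices at distance $n-1$ from the root (the root is generation $1$); its labels, read from left to right, are denoted $x_1^{(n)},\dots,x_{2^{n-1}}^{(n)}$. *)

theory Defs
  imports Complex_Main
begin

codatatype 'a btree = Node (label: 'a) (left: "'a btree") (right: "'a btree")

primrec level :: "nat \<Rightarrow> 'a btree \<Rightarrow> 'a list" where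
  "level 0 t = [label t]"
| "level (Suc d) t = level d (left t) @ level d (right t)"

lemma length_level: "length (level d t) = 2 ^ d"
  by (induction d arbitrary: t) auto

(* quotient_of yields the reduced fraction with positive denominator. *)
definition cw_left :: "rat \<Rightarrow> rat" where
  "cw_left q = (let (a, b) = quotient_of q in of_int a / of_int (a + b))"

definition cw_right :: "rat \<Rightarrow> rat" where
  "cw_right q = (let (a, b) = quotient_of q in of_int (a + b) / of_int b)"

primcorec cw_tree_from :: "rat \<Rightarrow> rat btree" where
  "cw_tree_from q = Node q (cw_tree_from (cw_left q)) (cw_tree_from (cw_right q))"

definition calkin_wilf_tree :: "rat btree" where
  "calkin_wilf_tree = cw_tree_from 1"

(* Generations are numbered from 1; the value at n = 0 is junk. *)
definition cw_generation :: "nat \<Rightarrow> rat list" where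
  "cw_generation n = level (n - 1) calkin_wilf_tree"

lemma length_cw_generation: "length (cw_generation n) = 2 ^ (n - 1)"
  by (simp add: cw_generation_def length_level)

(* The j-th label of generation n from the left, meaningful for 1 \<le> j \<le> 2 ^ (n - 1). *)
definition cw_elem :: "nat \<Rightarrow> nat \<Rightarrow> rat" where
  "cw_elem n j = cw_generation n ! (j - 1)"

end

theory Submission
  imports Defs
begin

text \<open>
  Write \<open>S d q\<close> for the sum of level \<open>d\<close> of the tree rooted at \<open>q > 0\<close>. The left child of \<open>q\<close>
  is \<open>1 / (1 / q + 1)\<close>, the reciprocal of the right child of \<open>1 / q\<close>. Hence the symmetrised sum
  \<open>T d q = S d q + S d (1 / q)\<close> satisfies \<open>T (d + 1) q = T d (q + 1) + T d (1 / q + 1)\<close>, and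
  induction gives \<open>T d q = q + 1 / q + 3 * (2 ^ d - 1)\<close>. At \<open>q = 1\<close> both summands coincide.
\<close>

lemma cw_right_eq: "cw_right q = q + 1"
proof -
  obtain a b where ab: "quotient_of q = (a, b)" by fastforce
  with quotient_of_denom_pos[OF ab] quotient_of_div[OF ab] show ?thesis
    by (simp add: cw_right_def field_simps)
qed

lemma cw_left_eq:
  assumes "q > 0"
  shows "cw_left q = 1 / (1 / q + 1)"
proof -
  obtain a b where ab: "quotient_of q = (a, b)" by fastforce
  have q: "q = of_int a / of_int b" and b: "b > 0"
    using quotient_of_div[OF ab] quotient_of_denom_pos[OF ab] by auto
  \<comment> \<open>Positivity of \<open>a\<close> keeps both \<open>a\<close> and
    \<open>a + b\<close> nonzero, so all fractions can be cleared.\<close>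
  with assms have "a > 0" by (simp add: zero_less_divide_iff)
  with b have "of_int a / of_int (a + b) = 1 / (1 / q + 1)"
    by (simp add: q field_simps)
  with ab show ?thesis by (simp add: cw_left_def)
qed

lemma sum_list_level_add_reciprocal:
  assumes "q > 0"
  shows "sum_list (level d (cw_tree_from q)) + sum_list (level d (cw_tree_from (1 / q)))
    = q + 1 / q + 3 * (2 ^ d - 1)"
  using assms
proof (induction d arbitrary: q)
  case 0
  then show ?case by simp
next
  case (Suc d)
  let ?S = "\<lambda>x. sum_list (level d (cw_tree_from x))"
  have "?S (q + 1) + ?S (1 / (q + 1)) = q + 1 + 1 / (q + 1) + 3 * (2 ^ d - 1)"
    using Suc.prems by (intro Suc.IH) simp
  moreover have "?S (1 / q + 1) + ?S (1 / (1 / q + 1))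
      = 1 / q + 1 + 1 / (1 / q + 1) + 3 * (2 ^ d - 1)"
    using Suc.prems by (intro Suc.IH) (simp add: add_pos_pos)
  moreover have "sum_list (level (Suc d) (cw_tree_from q))
        + sum_list (level (Suc d) (cw_tree_from (1 / q)))
      = (?S (q + 1) + ?S (1 / (q + 1))) + (?S (1 / q + 1) + ?S (1 / (1 / q + 1)))"
    using Suc.prems by (simp add: cw_left_eq cw_right_eq)
  ultimately have "sum_list (level (Suc d) (cw_tree_from q))
        + sum_list (level (Suc d) (cw_tree_from (1 / q)))
      = (q + 1 + 1 / (q + 1) + 3 * (2 ^ d - 1)) + (1 / q + 1 + 1 / (1 / q + 1) + 3 * (2 ^ d - 1))"
    by (simp only:)
  \<comment> \<open>The terms \<open>1 / (q + 1)\<close> now cancel, leaving the constant 3 + 6 *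
    (2^d - 1) = 3 * (2^(d+1) - 1).\<close>
  also have "1 / (1 / q + 1) = 1 - 1 / (q + 1)"
    using Suc.prems by (simp add: field_simps)
  finally show ?case by (simp add: algebra_simps)
qed

theorem theorem1:
  fixes n :: nat
  assumes "n \<ge> 1"
  shows "(\<Sum>j = 1..2 ^ (n - 1). cw_elem n j) = 3 * 2 powi (int n - 2) - 1 / 2"
proof -
  have "(\<Sum>j = 1..2 ^ (n - 1). cw_elem n j) = sum_list (cw_generation n)"
    by (simp add: sum_list_sum_nth length_cw_generation cw_elem_def
        sum.atLeast_Suc_atMost_Suc_shift sum.atLeast1_atMost_eq lessThan_atLeast0)
  \<comment> \<open>At \<open>q = 1\<close> twice the sum is 2 + 3 * (2^(n-1) - 1).\<close>
  also have "\<dots> = 3 * (2 ^ (n - 1) / 2) - 1 / 2"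
    using sum_list_level_add_reciprocal[of 1 "n - 1"]
    by (simp add: cw_generation_def calkin_wilf_tree_def)
  \<comment> \<open>The exponent is -1 at \<open>n = 1\<close>, hence \<open>powi\<close>;
    \<open>n \<ge> 1\<close> makes the truncated \<open>n - 1\<close> exact.\<close>
  also have "2 ^ (n - 1) / 2 = (2 :: rat) powi (int n - 2)"
    using assms power_int_diff[of "2 :: rat" "int (n - 1)" 1]
    by (simp add: of_nat_diff flip: power_int_of_nat)
  finally show ?thesis .
qed

end
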